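(* Let $q$ be a positive integer. A two-spine configuration $P\subseteq\Omega_{2,q}$ is coverable if and only if, viewed as a bipartite graph, it is a pseudoforest; equivalently, every connected component contains at most one cycle.
   Context: $[q]=\{0,\dots,q-1\}$ and $\Omega_{2,q}=\{(x,y)\in[q]^2:x\ne y\}$. A two-spine configuration is a subset $P\subseteq\Omega_{2,q}$. It is viewed as a bipartite graph: an ordered pair $(x,y)\in P$ is an edge joining the row copy of $x$ to the column copy of $y$; row $c$ and column $c$ are distinct vertices (and the diagonal edge $(c,c)$ never occurs). $P$ is coverable if it can be partitioned as $P=P_1\,\dot\cup\,P_2$ (parts may be empty) where $P_1$ contains at most one pair with any given second coordinate and $P_2$ contains at most one pair with any given first coordinate. A pseudoforest is a graph in which every connected component contains at most one cycle. *)

theory Defs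
  imports Main
begin

text \<open>
  A finite simple graph is given by its vertex set and its set of edges, an edge being the
  two-element set of its endpoints.
\<close>

definition adjacency :: "'v set set \<Rightarrow> ('v \<times> 'v) set" where
  "adjacency E = {(u, v). {u, v} \<in> E}"

definition components :: "'v set \<Rightarrow> 'v set set \<Rightarrow> 'v set set" where
  "components V E = V // ((adjacency E)\<^sup>* \<inter> V \<times> V)"

definition induced_edges :: "'v set set \<Rightarrow> 'v set \<Rightarrow> 'v set set" where
  "induced_edges E C = {e \<in> E. e \<subseteq> C}"

definition closed_walk_edges :: "'v list \<Rightarrow> 'v set set" where
  "closed_walk_edges vs = {{vs ! i, vs ! (Suc i mod length vs)} | i. i < length vs}"

text \<open>
  Cycles are counted as subgraphs, each represented by its edge set, so that the choice of a
  starting vertex and of a direction does not matter.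
\<close>

definition cycles :: "'v set set \<Rightarrow> 'v set set set" where
  "cycles E = {closed_walk_edges vs | vs.
     distinct vs \<and> 3 \<le> length vs \<and> closed_walk_edges vs \<subseteq> E}"

definition pseudoforest :: "'v set \<Rightarrow> 'v set set \<Rightarrow> bool" where
  "pseudoforest V E \<longleftrightarrow>
     (\<forall>C \<in> components V E. \<exists>\<^sub>\<le>\<^sub>1 F. F \<in> cycles (induced_edges E C))"

definition Omega2 :: "nat \<Rightarrow> (nat \<times> nat) set" where
  "Omega2 q = {(x, y). x \<in> {0..<q} \<and> y \<in> {0..<q} \<and> x \<noteq> y}"

definition coverable :: "(nat \<times> nat) set \<Rightarrow> bool" where
  "coverable P \<longleftrightarrow> (\<exists>P1 P2. P = P1 \<union> P2 \<and> P1 \<inter> P2 = {} \<and>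
     (\<forall>y. \<exists>\<^sub>\<le>\<^sub>1 x. (x, y) \<in> P1) \<and> (\<forall>x. \<exists>\<^sub>\<le>\<^sub>1 y. (x, y) \<in> P2))"

datatype spine_vertex = Row nat | Col nat

definition spine_vertices :: "nat \<Rightarrow> spine_vertex set" where
  "spine_vertices q = Row ` {0..<q} \<union> Col ` {0..<q}"

definition spine_edges :: "(nat \<times> nat) set \<Rightarrow> spine_vertex set set" where
  "spine_edges P = {{Row x, Col y} | x y. (x, y) \<in> P}"

end

theory Submission
  imports Defs "HOL-Library.Transitive_Closure_Table"
begin

text \<open>
  A covering is an orientation: an injective choice \<open>f\<close> of an endpoint for every edge. Let
  \<open>v \<rightarrow> w\<close> when \<open>f {v, w} = v\<close>. This relation is single-valued, so two vertices of the same
  component have a common descendant. A cycle has as many edges as vertices, so it is cyclically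
  oriented and closed under descendants; hence two cycles of one component have the same vertices
  and are equal.

  Conversely, one removes an edge \<open>e = {u, v}\<close>, orients the rest so that one of the endpoints
  remains unused, and assigns that endpoint to \<open>e\<close>. For the induction one prescribes a set \<open>U\<close> of
  vertices to be avoided and counts each of them as a cycle (a loop). If neither endpoint could be
  added to \<open>U\<close>, both would be connected to a cycle in the graph without \<open>e\<close>, necessarily the same
  one; then \<open>e\<close> lies on a second cycle.
\<close>

section \<open>Cycles\<close>

text \<open>With indices read modulo the length, the closing edge is no special case and the walk
  may be shifted or run around several times.\<close>

lemma closed_walk_edges_mod:
  assumes "vs \<noteq> []"
  shows "closed_walk_edges vs =
    range (\<lambda>i. {vs ! (i mod length vs), vs ! (Suc i mod length vs)})" (is "_ = range ?e")
proof -
  have "?e i \<in> closed_walk_edges vs" for i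
  proof -
    have "i mod length vs < length vs" using assms by simp
    moreover have "?e i = {vs ! (i mod length vs), vs ! (Suc (i mod length vs) mod length vs)}"
      by (simp add: mod_Suc_eq)
    ultimately show ?thesis unfolding closed_walk_edges_def by blast
  qed
  moreover have "e \<in> range ?e" if "e \<in> closed_walk_edges vs" for e
    using that unfolding closed_walk_edges_def by force
  ultimately show ?thesis by blast
qed

lemma nth_mod_length_surj:
  assumes "a \<in> set vs"
  obtains i where "a = vs ! (i mod length vs)"
  using assms by (metis in_set_conv_nth mod_less)

lemma Union_closed_walk_edges:
  assumes "vs \<noteq> []"
  shows "\<Union> (closed_walk_edges vs) = set vs"
proof
  show "\<Union> (closed_walk_edges vs) \<subseteq> set vs"
    using assms by (auto simp: closed_walk_edges_mod)
  show "set vs \<subseteq> \<Union> (closed_walk_edges vs)"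
    using assms by (fastforce simp: closed_walk_edges_mod elim: nth_mod_length_surj)
qed

lemma cyclic_rtrancl:
  assumes step: "\<And>i. (vs ! (i mod length vs), vs ! (Suc i mod length vs)) \<in> r"
    and "a \<in> set vs" "b \<in> set vs"
  shows "(a, b) \<in> r\<^sup>*"
proof -
  obtain i where i: "a = vs ! (i mod length vs)" using assms(2) by (rule nth_mod_length_surj)
  obtain j where j: "b = vs ! (j mod length vs)" using assms(3) by (rule nth_mod_length_surj)
  have *: "(vs ! (i mod length vs), vs ! ((i + k) mod length vs)) \<in> r\<^sup>*" for k
  proof (induction k)
    case (Suc k)
    then show ?case using step[of "i + k"] by (simp add: rtrancl.rtrancl_into_rtrancl)
  qed simp
  \<comment> \<open>Adding \<open>i\<close> full turns to \<open>j\<close> keeps its residue and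
    makes it at least \<open>i\<close>, so \<open>b\<close> is reached by going forward
    only.\<close>
  have "i \<le> j + i * length vs" using assms(2) by (cases vs) auto
  then obtain k where "j + i * length vs = i + k" using le_Suc_ex by blast
  then have "(i + k) mod length vs = j mod length vs" by (metis mod_mult_self1)
  then show ?thesis using *[of k] i j by simp
qed

section \<open>Connectivity, and cycles through a given edge\<close>

lemma sym_adjacency: "sym (adjacency E)"
  by (auto simp: adjacency_def sym_def insert_commute)

lemma adjacency_rtrancl_sym: "(u, v) \<in> (adjacency E)\<^sup>* \<Longrightarrow> (v, u) \<in> (adjacency E)\<^sup>*"
  by (meson sym_adjacency sym_rtrancl symD)

lemma adjacency_rtrancl_mono:
  "E' \<subseteq> E \<Longrightarrow> (u, v) \<in> (adjacency E')\<^sup>* \<Longrightarrow> (u, v) \<in> (adjacency E)\<^sup>*"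
  by (rule subsetD[OF rtrancl_mono]) (auto simp: adjacency_def)

lemma cycles_mono: "E' \<subseteq> E \<Longrightarrow> cycles E' \<subseteq> cycles E"
  unfolding cycles_def by blast

lemma cycles_subset: "F \<in> cycles E \<Longrightarrow> F \<subseteq> E"
  unfolding cycles_def by blast

lemma cycles_Union_nonempty:
  assumes "F \<in> cycles E"
  obtains a where "a \<in> \<Union> F"
proof -
  obtain vs where "F = closed_walk_edges vs" "3 \<le> length vs"
    using assms unfolding cycles_def by blast
  moreover from this have "vs \<noteq> []" by auto
  ultimately have "\<Union> F = set vs" "set vs \<noteq> {}" by (simp_all add: Union_closed_walk_edges)
  then show ?thesis using that by (metis ex_in_conv)
qed

lemma cycle_connected:
  assumes "F \<in> cycles E" "a \<in> \<Union> F" "b \<in> \<Union> F"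
  shows "(a, b) \<in> (adjacency E)\<^sup>*"
proof -
  obtain vs where vs: "F = closed_walk_edges vs" "3 \<le> length vs" "F \<subseteq> E"
    using assms(1) unfolding cycles_def by blast
  then have ne: "vs \<noteq> []" by auto
  have "(vs ! (i mod length vs), vs ! (Suc i mod length vs)) \<in> adjacency E" for i
    using vs ne by (auto simp: adjacency_def closed_walk_edges_mod)
  then show ?thesis
    using cyclic_rtrancl[of vs "adjacency E"] assms(2,3) Union_closed_walk_edges[OF ne] vs(1) by auto
qed

text \<open>A path from \<open>u\<close> to \<open>v\<close> that avoids \<open>e\<close> can be
  made simple, and \<open>e\<close> closes it to a cycle.\<close>

lemma edge_on_cycle:
  assumes "e \<in> E" "e = {u, v}" "u \<noteq> v" and conn: "(u, v) \<in> (adjacency (E - {e}))\<^sup>*"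
  obtains F where "F \<in> cycles E" "e \<in> F"
proof -
  let ?r = "\<lambda>x y. (x, y) \<in> adjacency (E - {e})"
  have "?r\<^sup>*\<^sup>* u v" using conn by (simp add: rtranclp_rtrancl_eq)
  then obtain xs0 where "rtrancl_path ?r u xs0 v" by (auto simp: rtranclp_eq_rtrancl_path)
  then obtain xs where path: "rtrancl_path ?r u xs v" and dist: "distinct (u # xs)"
    by (rule rtrancl_path_distinct)
  let ?vs = "u # xs"
  have ne: "xs \<noteq> []" using path assms(3) by (auto elim: rtrancl_path.cases)
  have last: "xs ! (length xs - 1) = v"
    using rtrancl_path_last[OF path ne] ne by (simp add: last_conv_nth)
  have step: "{?vs ! i, xs ! i} \<in> E - {e}" if "i < length xs" for i
    using rtrancl_path_nth[OF path that] by (simp add: adjacency_def)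
  \<comment> \<open>A path with a single step would consist of \<open>e\<close>, which has been
    removed; so the cycle has at least three vertices.\<close>
  have len: "length xs \<noteq> 1"
  proof
    assume "length xs = 1"
    then show False using step[of 0] last assms(2) by simp
  qed
  have "closed_walk_edges ?vs \<subseteq> E"
  proof
    fix d assume "d \<in> closed_walk_edges ?vs"
    then obtain i where i: "i < length ?vs" "d = {?vs ! i, ?vs ! (Suc i mod length ?vs)}"
      unfolding closed_walk_edges_def by blast
    show "d \<in> E"
    proof (cases "i < length xs")
      case True
      then show ?thesis using step[OF True] i by simp
    next
      case False
      then have "i = length xs" using i by simp
      then show ?thesis using i last ne assms(1,2) by (simp add: nth_Cons' insert_commute)
    qed
  qed
  moreover have "e \<in> closed_walk_edges ?vs"
  proof -
    have "e = {?vs ! length xs, ?vs ! (Suc (length xs) mod length ?vs)}"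
      using last ne assms(2) by (simp add: nth_Cons' insert_commute)
    then show ?thesis unfolding closed_walk_edges_def by (intro CollectI exI[of _ "length xs"]) simp
  qed
  moreover have "3 \<le> length ?vs" using ne len by (cases xs) (auto simp: Suc_le_eq)
  ultimately show ?thesis using that dist unfolding cycles_def by blast
qed

section \<open>Orientations\<close>

text \<open>\<open>f e\<close> is the tail of \<open>e\<close>; injectivity bounds all outdegrees by
  one.\<close>

definition orients :: "('v set \<Rightarrow> 'v) \<Rightarrow> 'v set set \<Rightarrow> bool" where
  "orients f E \<longleftrightarrow> inj_on f E \<and> (\<forall>e \<in> E. f e \<in> e)"

definition out_rel :: "('v set \<Rightarrow> 'v) \<Rightarrow> 'v set set \<Rightarrow> ('v \<times> 'v) set" where
  "out_rel f E = {(v, w). {v, w} \<in> E \<and> f {v, w} = v}"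

lemma out_rel_unique:
  assumes "orients f E" "(v, w) \<in> out_rel f E" "(v, w') \<in> out_rel f E"
  shows "w = w'"
proof -
  have "{v, w} = {v, w'}"
    using assms inj_onD[of f E "{v, w}" "{v, w'}"] unfolding orients_def out_rel_def by simp
  then show ?thesis by (auto simp: doubleton_eq_iff)
qed

text \<open>Induction along an undirected path. If the new edge points to \<open>b\<close>, the old
  descendant \<open>c\<close> remains. If it leaves \<open>b\<close>, it is the only arrow there, so
  a nontrivial directed path from \<open>b\<close> to \<open>c\<close> passes through
  \<open>b'\<close>; if \<open>b = c\<close>, then \<open>b'\<close> becomes the common
  descendant.\<close>

lemma common_descendant:
  assumes "orients f E" "(a, b) \<in> (adjacency E)\<^sup>*"
  shows "\<exists>c. (a, c) \<in> (out_rel f E)\<^sup>* \<and> (b, c) \<in> (out_rel f E)\<^sup>*"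
  using assms(2)
proof (induction rule: rtrancl_induct)
  case (step b b')
  then obtain c where c: "(a, c) \<in> (out_rel f E)\<^sup>*" "(b, c) \<in> (out_rel f E)\<^sup>*" by blast
  have "{b, b'} \<in> E" using step by (simp add: adjacency_def)
  then have "f {b, b'} \<in> {b, b'}" using assms(1) unfolding orients_def by blast
  with \<open>{b, b'} \<in> E\<close> consider "(b, b') \<in> out_rel f E" | "(b', b) \<in> out_rel f E"
    by (auto simp: out_rel_def insert_commute)
  then show ?case
  proof cases
    case 1
    show ?thesis
    proof (cases "b = c")
      case True
      then show ?thesis using c 1 by (meson rtrancl.simps)
    next
      case False
      then obtain x where "(b, x) \<in> out_rel f E" "(x, c) \<in> (out_rel f E)\<^sup>*"
        using c(2) by (meson converse_rtranclE)
      then show ?thesis using out_rel_unique[OF assms(1) 1] c(1) by blast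
    qed
  next
    case 2
    then show ?thesis using c by (meson converse_rtrancl_into_rtrancl)
  qed
qed blast

section \<open>Cycles under an orientation\<close>

lemma consecutive_edges_neq:
  assumes "distinct vs" "3 \<le> length vs"
  shows "{vs ! (i mod length vs), vs ! (Suc i mod length vs)} \<noteq>
    {vs ! (Suc i mod length vs), vs ! (Suc (Suc i) mod length vs)}"
proof
  let ?n = "length vs"
  assume "{vs ! (i mod ?n), vs ! (Suc i mod ?n)} = {vs ! (Suc i mod ?n), vs ! (Suc (Suc i) mod ?n)}"
  then have "vs ! (i mod ?n) = vs ! (Suc (Suc i) mod ?n)" by (auto simp: doubleton_eq_iff)
  moreover have "i mod ?n < ?n" "Suc (Suc i) mod ?n < ?n"
    using assms(2) by (auto intro!: mod_less_divisor)
  ultimately have "i mod ?n = Suc (Suc i) mod ?n"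
    using assms(1) nth_eq_iff_index_eq by blast
  \<comment> \<open>The length would divide 2.\<close>
  then have "?n dvd Suc (Suc i) - i" by (metis mod_eq_dvd_iff_nat le_SucI order_refl)
  then show False using assms(2) by (auto dest: dvd_imp_le)
qed

text \<open>Consecutive edges are distinct and cannot both choose their common vertex. Hence once an
  edge chooses its second vertex, so does the next one, and this propagates around the whole
  cycle.\<close>

lemma cycle_cyclically_oriented:
  assumes "orients f E" "distinct vs" "3 \<le> length vs" "closed_walk_edges vs \<subseteq> E"
  defines "v \<equiv> \<lambda>i. vs ! (i mod length vs)"
  shows "(\<forall>i. f {v i, v (Suc i)} = v (Suc i)) \<or> (\<forall>i. f {v i, v (Suc i)} = v i)"
proof (rule disjCI)
  have ne: "vs \<noteq> []" using assms(3) by auto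
  have E: "{v i, v (Suc i)} \<in> E" for i
    using assms(4) ne by (auto simp: closed_walk_edges_mod v_def)
  have mem: "f {v i, v (Suc i)} = v i \<or> f {v i, v (Suc i)} = v (Suc i)" for i
    using assms(1) E[of i] unfolding orients_def by blast
  have step: "f {v (Suc i), v (Suc (Suc i))} = v (Suc (Suc i))"
    if "f {v i, v (Suc i)} = v (Suc i)" for i
  proof (rule ccontr)
    assume "\<not> ?thesis"
    then have "f {v (Suc i), v (Suc (Suc i))} = f {v i, v (Suc i)}"
      using mem[of "Suc i"] that by simp
    then have "{v (Suc i), v (Suc (Suc i))} = {v i, v (Suc i)}"
      using assms(1) E unfolding orients_def by (meson inj_onD)
    then show False using consecutive_edges_neq[OF assms(2,3), of i] unfolding v_def by metis
  qed
  assume "\<not> (\<forall>i. f {v i, v (Suc i)} = v i)"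
  then obtain i where i: "f {v i, v (Suc i)} = v (Suc i)" using mem by blast
  have fwd: "f {v (i + k), v (Suc (i + k))} = v (Suc (i + k))" for k
    by (induction k) (use i step in auto)
  show "\<forall>j. f {v j, v (Suc j)} = v (Suc j)"
  proof
    fix j
    let ?m = "j + i * length vs"
    have "i \<le> ?m" using ne by (cases vs) auto
    then obtain k where "?m = i + k" using le_Suc_ex by blast
    moreover have "v ?m = v j" "v (Suc ?m) = v (Suc j)"
      unfolding v_def by (metis mod_mult_self1, metis add_Suc mod_mult_self1)
    ultimately show "f {v j, v (Suc j)} = v (Suc j)" using fwd[of k] by simp
  qed
qed

lemma oriented_cycle:
  assumes "orients f E" "F \<in> cycles E"
  shows "f ` F = \<Union> F"
    and "\<And>a b. a \<in> \<Union> F \<Longrightarrow> b \<in> \<Union> F \<Longrightarrow> (a, b) \<in> (out_rel f E)\<^sup>*"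
proof -
  obtain vs where vs: "F = closed_walk_edges vs" "distinct vs" "3 \<le> length vs" "F \<subseteq> E"
    using assms(2) unfolding cycles_def by blast
  then have ne: "vs \<noteq> []" by auto
  define v where "v = (\<lambda>i. vs ! (i mod length vs))"
  have F: "F = range (\<lambda>i. {v i, v (Suc i)})"
    using vs(1) ne by (simp add: closed_walk_edges_mod v_def)
  have UF: "\<Union> F = set vs" using vs(1) ne by (simp add: Union_closed_walk_edges)
  have E: "{v i, v (Suc i)} \<in> E" for i using F vs(4) by auto
  have surj: "\<exists>i. a = v i" if "a \<in> set vs" for a
    using that unfolding v_def by (metis nth_mod_length_surj)
  have surj': "\<exists>i. a = v (Suc i)" if a: "a \<in> set vs" for a
  proof -
    obtain i where i: "a = v i" using surj a by blast
    \<comment> \<open>The predecessor of index \<open>i\<close> is found by going almost a full turn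
      forward.\<close>
    have "Suc (i + (length vs - 1)) = i + length vs" using ne by (cases vs) auto
    then have "v (Suc (i + (length vs - 1))) = v i" by (simp only: v_def mod_add_self2)
    then show ?thesis using i by metis
  qed
  have sub: "f ` F \<subseteq> \<Union> F" using assms(1) vs(4) unfolding orients_def by blast
  consider "\<forall>i. f {v i, v (Suc i)} = v (Suc i)" | "\<forall>i. f {v i, v (Suc i)} = v i"
    using cycle_cyclically_oriented[OF assms(1) vs(2,3)] vs(1,4) unfolding v_def by blast
  then have "f ` F = \<Union> F \<and> (\<forall>a \<in> \<Union> F. \<forall>b \<in> \<Union> F. (a, b) \<in> (out_rel f E)\<^sup>*)"
  proof cases
    case 1
    have "v (Suc i) \<in> f ` F" for i
      using 1 by (intro image_eqI[of _ f "{v i, v (Suc i)}"]) (auto simp: F)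
    then have "set vs \<subseteq> f ` F" using surj' by blast
    \<comment> \<open>Here the arrows run against the order of the list, so reachability is shown
      for the converse relation.\<close>
    moreover have "(v i, v (Suc i)) \<in> (out_rel f E)\<inverse>" for i
      using 1 E[of i] by (simp add: out_rel_def insert_commute)
    then have "(b, a) \<in> ((out_rel f E)\<inverse>)\<^sup>*" if "a \<in> set vs" "b \<in> set vs" for a b
      using cyclic_rtrancl[of vs _ b a] that unfolding v_def by blast
    ultimately show ?thesis using sub UF by (auto simp: rtrancl_converse)
  next
    case 2
    have "v i \<in> f ` F" for i
      using 2 by (intro image_eqI[of _ f "{v i, v (Suc i)}"]) (auto simp: F)
    then have "set vs \<subseteq> f ` F" using surj by blast
    moreover have "(v i, v (Suc i)) \<in> out_rel f E" for i
      using 2 E[of i] by (simp add: out_rel_def)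
    then have "(a, b) \<in> (out_rel f E)\<^sup>*" if "a \<in> set vs" "b \<in> set vs" for a b
      using cyclic_rtrancl[of vs _ a b] that unfolding v_def by blast
    ultimately show ?thesis using sub UF by auto
  qed
  then show "f ` F = \<Union> F"
    and "\<And>a b. a \<in> \<Union> F \<Longrightarrow> b \<in> \<Union> F \<Longrightarrow> (a, b) \<in> (out_rel f E)\<^sup>*" by blast+
qed

text \<open>The edges of \<open>F\<close> already use up all its vertices, so by injectivity no
  other edge can choose one of them. In particular a cycle is determined by its vertex set.\<close>

lemma oriented_cycle_eq_preimage:
  assumes "orients f E" "F \<in> cycles E"
  shows "F = {e \<in> E. f e \<in> \<Union> F}"
proof -
  have "inj_on f E" "F \<subseteq> E" using assms cycles_subset by (auto simp: orients_def)
  then have "{e \<in> E. f e \<in> f ` F} = F" by (auto dest: inj_onD)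
  then show ?thesis using oriented_cycle(1)[OF assms] by simp
qed

lemma oriented_cycle_closed:
  assumes "orients f E" "F \<in> cycles E" "(a, b) \<in> (out_rel f E)\<^sup>*" "a \<in> \<Union> F"
  shows "b \<in> \<Union> F"
  using assms(3,4)
proof (induction rule: rtrancl_induct)
  case (step b c)
  then have "{b, c} \<in> E" "f {b, c} \<in> \<Union> F" by (auto simp: out_rel_def)
  then have "{b, c} \<in> F" using oriented_cycle_eq_preimage[OF assms(1,2)] by blast
  then show ?case by blast
qed

text \<open>A common descendant of \<open>a\<close> and \<open>b\<close> lies on both cycles.
  Directed paths from it reach every vertex of either cycle and leave neither, so the vertex sets
  agree.\<close>

lemma oriented_cycles_unique:
  assumes o: "orients f E" and F: "F \<in> cycles E" and G: "G \<in> cycles E"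
    and ab: "a \<in> \<Union> F" "b \<in> \<Union> G" "(a, b) \<in> (adjacency E)\<^sup>*"
  shows "F = G"
proof -
  obtain c where "(a, c) \<in> (out_rel f E)\<^sup>*" "(b, c) \<in> (out_rel f E)\<^sup>*"
    using common_descendant[OF o ab(3)] by blast
  then have c: "c \<in> \<Union> F" "c \<in> \<Union> G"
    using oriented_cycle_closed[OF o] F G ab by blast+
  have "\<Union> F = \<Union> G"
    using oriented_cycle(2)[OF o F c(1)] oriented_cycle(2)[OF o G c(2)]
      oriented_cycle_closed[OF o F _ c(1)] oriented_cycle_closed[OF o G _ c(2)] by blast
  then show ?thesis
    using oriented_cycle_eq_preimage[OF o F] oriented_cycle_eq_preimage[OF o G] by simp
qed

section \<open>Existence of orientations\<close>

text \<open>A vertex \<open>x \<in> U\<close> is represented by the loop \<open>{{x}}\<close>.\<close>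

definition rooted_cycles :: "'v set set \<Rightarrow> 'v set \<Rightarrow> 'v set set set" where
  "rooted_cycles E U = cycles E \<union> {{{x}} | x. x \<in> U}"

text \<open>Stated through reachability rather than components, so that the induction on edges need
  not carry a vertex set.\<close>

definition cycles_separated :: "'v set set \<Rightarrow> 'v set \<Rightarrow> bool" where
  "cycles_separated E U \<longleftrightarrow> (\<forall>F \<in> rooted_cycles E U. \<forall>G \<in> rooted_cycles E U.
     \<forall>a \<in> \<Union> F. \<forall>b \<in> \<Union> G. (a, b) \<in> (adjacency E)\<^sup>* \<longrightarrow> F = G)"

lemma cycles_separatedD:
  "cycles_separated E U \<Longrightarrow> F \<in> rooted_cycles E U \<Longrightarrow> G \<in> rooted_cycles E U \<Longrightarrow>
    a \<in> \<Union> F \<Longrightarrow> b \<in> \<Union> G \<Longrightarrow> (a, b) \<in> (adjacency E)\<^sup>* \<Longrightarrow> F = G"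
  unfolding cycles_separated_def by blast

lemma rooted_cycles_mono: "E' \<subseteq> E \<Longrightarrow> rooted_cycles E' U \<subseteq> rooted_cycles E U"
  using cycles_mono unfolding rooted_cycles_def by blast

lemma rooted_cycle_connected:
  assumes "F \<in> rooted_cycles E U" "a \<in> \<Union> F" "b \<in> \<Union> F"
  shows "(a, b) \<in> (adjacency E)\<^sup>*"
proof (cases "F \<in> cycles E")
  case True
  then show ?thesis using assms(2,3) by (rule cycle_connected)
next
  case False
  then show ?thesis using assms by (auto simp: rooted_cycles_def)
qed

text \<open>The endpoint \<open>z\<close> lies in a component of \<open>E - {e}\<close> without
  rooted cycles; such a vertex can join \<open>U\<close> without spoiling separation.\<close>

lemma separated_endpoint:
  assumes sep: "cycles_separated E U" and e: "e \<in> E" "e = {u, v}" "u \<noteq> v"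
  shows "\<exists>z \<in> e. \<forall>F \<in> rooted_cycles (E - {e}) U. \<forall>a \<in> \<Union> F.
    (z, a) \<notin> (adjacency (E - {e}))\<^sup>*"
proof (rule ccontr)
  let ?E = "E - {e}"
  let ?A = "(adjacency ?E)\<^sup>*"
  assume neg: "\<not> ?thesis"
  then obtain F a where F: "F \<in> rooted_cycles ?E U" "a \<in> \<Union> F" "(u, a) \<in> ?A"
    using e(2) by blast
  obtain G b where G: "G \<in> rooted_cycles ?E U" "b \<in> \<Union> G" "(v, b) \<in> ?A"
    using e(2) neg by blast
  have up: "(x, y) \<in> (adjacency E)\<^sup>*" if "(x, y) \<in> ?A" for x y
    using that by (rule adjacency_rtrancl_mono[rotated]) blast
  have FG: "F \<in> rooted_cycles E U" "G \<in> rooted_cycles E U"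
    using F(1) G(1) rooted_cycles_mono[of ?E E U] by blast+
  have uv: "(u, v) \<in> adjacency E" using e by (simp add: adjacency_def)
  have "(a, b) \<in> (adjacency E)\<^sup>*"
    using up[OF adjacency_rtrancl_sym[OF F(3)]] uv up[OF G(3)]
    by (meson rtrancl.rtrancl_into_rtrancl rtrancl_trans)
  then have "F = G" using cycles_separatedD[OF sep FG F(2) G(2)] by blast
  \<comment> \<open>The shared rooted cycle avoids \<open>e\<close> and thus links \<open>u\<close>
    to \<open>v\<close> without it.\<close>
  then have "(a, b) \<in> ?A" using rooted_cycle_connected[OF F(1,2)] G(2) by blast
  then have "(u, v) \<in> ?A"
    using F(3) adjacency_rtrancl_sym[OF G(3)] by (meson rtrancl_trans)
  then obtain H where H: "H \<in> cycles E" "e \<in> H" using edge_on_cycle e by metis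
  then have "H \<in> rooted_cycles E U" "u \<in> \<Union> H" using e(2) by (auto simp: rooted_cycles_def)
  then have "H = F" using cycles_separatedD[OF sep _ FG(1) _ F(2) up[OF F(3)]] by blast
  \<comment> \<open>\<open>F\<close> is a cycle of \<open>E - {e}\<close> or a loop, and
    \<open>e\<close> has two distinct endpoints.\<close>
  moreover have "e \<notin> F"
    using F(1) cycles_subset e(2,3) unfolding rooted_cycles_def by fastforce
  ultimately show False using H(2) by blast
qed

text \<open>The set \<open>U\<close> is what makes the induction work: the smaller graph is oriented
  while avoiding \<open>insert z U\<close>, which leaves \<open>z\<close> free to be chosen by
  \<open>e\<close>.\<close>

lemma orientation_avoiding:
  assumes "finite E" "\<forall>e \<in> E. card e = 2" "cycles_separated E U"
  shows "\<exists>f. orients f E \<and> f ` E \<inter> U = {}"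
  using assms
proof (induction E arbitrary: U rule: finite_induct)
  case empty
  then show ?case by (simp add: orients_def)
next
  case (insert e E)
  obtain u v where e: "e = {u, v}" "u \<noteq> v" using insert.prems(1) by (metis card_2_iff insertI1)
  have E: "insert e E - {e} = E" using insert.hyps by simp
  obtain z where z: "z \<in> e"
    "\<And>F a. F \<in> rooted_cycles E U \<Longrightarrow> a \<in> \<Union> F \<Longrightarrow> (z, a) \<notin> (adjacency E)\<^sup>*"
    using separated_endpoint[OF insert.prems(2) _ e] unfolding E by blast
  have "cycles_separated E (insert z U)"
    unfolding cycles_separated_def
  proof (intro ballI impI)
    fix F G a b
    assume F: "F \<in> rooted_cycles E (insert z U)" "a \<in> \<Union> F"
      and G: "G \<in> rooted_cycles E (insert z U)" "b \<in> \<Union> G"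
      and ab: "(a, b) \<in> (adjacency E)\<^sup>*"
    have z': "(a, z) \<notin> (adjacency E)\<^sup>*" if "F \<in> rooted_cycles E U" "a \<in> \<Union> F" for F a
      using z(2)[OF that] adjacency_rtrancl_sym by metis
    have split: "H \<in> rooted_cycles E U \<or> H = {{z}}"
      if "H \<in> rooted_cycles E (insert z U)" for H
      using that by (auto simp: rooted_cycles_def)
    have "F = G" if "F \<in> rooted_cycles E U" "G \<in> rooted_cycles E U"
    proof (rule cycles_separatedD[OF insert.prems(2) _ _ F(2) G(2)])
      show "F \<in> rooted_cycles (insert e E) U" "G \<in> rooted_cycles (insert e E) U"
        using that rooted_cycles_mono[of E "insert e E" U] by blast+
      show "(a, b) \<in> (adjacency (insert e E))\<^sup>*"
        using ab by (rule adjacency_rtrancl_mono[rotated]) blast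
    qed
    moreover have "False" if "F = {{z}}" "G \<in> rooted_cycles E U"
      using z(2)[OF that(2) G(2)] that(1) F(2) ab by simp
    moreover have "False" if "G = {{z}}" "F \<in> rooted_cycles E U"
      using z'[OF that(2) F(2)] that(1) G(2) ab by simp
    ultimately show "F = G" using split[OF F(1)] split[OF G(1)] by blast
  qed
  then obtain f where f: "orients f E" "f ` E \<inter> insert z U = {}"
    using insert.IH[of "insert z U"] insert.prems(1) by auto
  \<comment> \<open>Otherwise \<open>{{z}}\<close> would be a rooted cycle, reached from
    \<open>z\<close> by the empty path.\<close>
  have "z \<notin> U" using z(2)[of "{{z}}" z] by (auto simp: rooted_cycles_def)
  have upd: "(f(e := z)) d = f d" if "d \<in> E" for d using that insert.hyps by auto
  then have img: "(f(e := z)) ` E = f ` E" by (rule image_cong[OF refl])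
  have "inj_on (f(e := z)) E = inj_on f E" by (rule inj_on_cong) (rule upd)
  then have "inj_on (f(e := z)) (insert e E)"
    using f insert.hyps img by (simp add: orients_def)
  moreover have "\<forall>d \<in> insert e E. (f(e := z)) d \<in> d"
    using f(1) z(1) by (simp add: orients_def)
  ultimately have "orients (f(e := z)) (insert e E)" by (simp add: orients_def)
  moreover have "(f(e := z)) ` insert e E \<inter> U = {}"
    using f(2) \<open>z \<notin> U\<close> unfolding image_insert img by auto
  ultimately show ?case by blast
qed

theorem orientation_iff_cycles_separated:
  assumes "finite E" "\<forall>e \<in> E. card e = 2"
  shows "(\<exists>f. orients f E) \<longleftrightarrow> cycles_separated E {}"
proof
  assume "\<exists>f. orients f E"
  then obtain f where f: "orients f E" ..
  have "rooted_cycles E {} = cycles E" by (simp add: rooted_cycles_def)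
  then show "cycles_separated E {}"
    unfolding cycles_separated_def by (metis oriented_cycles_unique[OF f])
next
  assume "cycles_separated E {}"
  then show "\<exists>f. orients f E" using orientation_avoiding[OF assms, of "{}"] by auto
qed

section \<open>Pseudoforests as graphs with separated cycles\<close>

lemma pseudoforest_iff_cycles_separated:
  assumes V: "\<And>e. e \<in> E \<Longrightarrow> e \<subseteq> V"
  shows "pseudoforest V E \<longleftrightarrow> cycles_separated E {}"
proof
  assume pf: "pseudoforest V E"
  show "cycles_separated E {}"
    unfolding cycles_separated_def
  proof (intro ballI impI)
    fix F G a b
    assume F: "F \<in> rooted_cycles E {}" "a \<in> \<Union> F" and G: "G \<in> rooted_cycles E {}" "b \<in> \<Union> G"
      and ab: "(a, b) \<in> (adjacency E)\<^sup>*"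
    define C where "C = ((adjacency E)\<^sup>* \<inter> V \<times> V) `` {a}"
    have cyc: "F \<in> cycles E" "G \<in> cycles E" using F G by (auto simp: rooted_cycles_def)
    have "a \<in> V" using F(2) cycles_subset[OF cyc(1)] V by blast
    then have C: "C \<in> components V E" unfolding C_def components_def by (rule quotientI)
    \<comment> \<open>Being connected, a cycle with one vertex in the component of \<open>a\<close>
      lies in it entirely.\<close>
    have sub: "H \<subseteq> induced_edges E C"
      if H: "H \<in> cycles E" "c \<in> \<Union> H" "(a, c) \<in> (adjacency E)\<^sup>*" for H c
    proof
      fix d assume "d \<in> H"
      then have d: "d \<in> E" "d \<subseteq> V" using cycles_subset[OF H(1)] V by blast+
      have "(a, x) \<in> (adjacency E)\<^sup>*" if "x \<in> d" for x
        using cycle_connected[OF H(1,2), of x] \<open>d \<in> H\<close> that H(3) by (meson UnionI rtrancl_trans)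
      then show "d \<in> induced_edges E C"
        using d \<open>a \<in> V\<close> by (auto simp: induced_edges_def C_def)
    qed
    have "F \<in> cycles (induced_edges E C)" "G \<in> cycles (induced_edges E C)"
      using sub[OF cyc(1) F(2)] sub[OF cyc(2) G(2) ab] cyc unfolding cycles_def by blast+
    then show "F = G" using pf C unfolding pseudoforest_def by (meson Uniq_D)
  qed
next
  assume sep: "cycles_separated E {}"
  show "pseudoforest V E"
    unfolding pseudoforest_def
  proof (intro ballI Uniq_I)
    fix C F G
    assume C: "C \<in> components V E"
      and F: "F \<in> cycles (induced_edges E C)" and G: "G \<in> cycles (induced_edges E C)"
    obtain c where c: "C = ((adjacency E)\<^sup>* \<inter> V \<times> V) `` {c}"
      using C unfolding components_def by (rule quotientE)
    have ind: "induced_edges E C \<subseteq> E" by (auto simp: induced_edges_def)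
    obtain a b where ab: "a \<in> \<Union> F" "b \<in> \<Union> G" using F G by (metis cycles_Union_nonempty)
    then have "a \<in> C" "b \<in> C"
      using cycles_subset[OF F] cycles_subset[OF G] by (auto simp: induced_edges_def)
    then have "(c, a) \<in> (adjacency E)\<^sup>*" "(c, b) \<in> (adjacency E)\<^sup>*"
      unfolding c by blast+
    then have "(a, b) \<in> (adjacency E)\<^sup>*"
      by (meson adjacency_rtrancl_sym rtrancl_trans)
    then show "F = G"
      using cycles_separatedD[OF sep _ _ ab] F G cycles_mono[OF ind]
      by (auto simp: rooted_cycles_def)
  qed
qed

section \<open>Two-spine configurations\<close>

lemma spine_edges_image: "spine_edges P = (\<lambda>(x, y). {Row x, Col y}) ` P"
  by (auto simp: spine_edges_def)

text \<open>Pairs in \<open>P1\<close> choose their column and pairs in \<open>P2\<close> their row.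
  The two uniqueness conditions are then injectivity on each part, and choices from different parts
  never collide because rows and columns are distinct vertices.\<close>

lemma coverable_iff_orientation: "coverable P \<longleftrightarrow> (\<exists>f. orients f (spine_edges P))"
proof
  assume "coverable P"
  then obtain P1 P2 where P: "P = P1 \<union> P2" "P1 \<inter> P2 = {}"
    and u: "\<And>x x' y. (x, y) \<in> P1 \<Longrightarrow> (x', y) \<in> P1 \<Longrightarrow> x = x'"
      "\<And>x y y'. (x, y) \<in> P2 \<Longrightarrow> (x, y') \<in> P2 \<Longrightarrow> y = y'"
    unfolding coverable_def Uniq_def by metis
  \<comment> \<open>\<open>f\<close> has to be defined on edges as sets, so \<open>h\<close>
    recovers the pair from its edge.\<close>
  define h where "h = inv_into UNIV (\<lambda>(x, y). {Row x, Col y})"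
  have inj: "inj (\<lambda>(x, y). {Row x, Col y})" by (auto simp: inj_def doubleton_eq_iff)
  have h: "h {Row x, Col y} = (x, y)" for x y
    using inv_into_f_f[OF inj, of "(x, y)"] by (simp add: h_def)
  define f where "f = (\<lambda>e. if h e \<in> P1 then Col (snd (h e)) else Row (fst (h e)))"
  have "orients f (spine_edges P)"
    unfolding orients_def
  proof
    show "inj_on f (spine_edges P)"
    proof (rule inj_onI)
      fix d e assume "d \<in> spine_edges P" "e \<in> spine_edges P" "f d = f e"
      then show "d = e" using P u unfolding spine_edges_def f_def
        by (auto simp: h split: if_splits)
    qed
    show "\<forall>e \<in> spine_edges P. f e \<in> e" by (auto simp: spine_edges_def f_def h)
  qed
  then show "\<exists>f. orients f (spine_edges P)" by blast
next
  assume "\<exists>f. orients f (spine_edges P)"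
  then obtain f where f: "inj_on f (spine_edges P)" "\<forall>e \<in> spine_edges P. f e \<in> e"
    unfolding orients_def by blast
  define P1 where "P1 = {(x, y) \<in> P. f {Row x, Col y} = Col y}"
  define P2 where "P2 = {(x, y) \<in> P. f {Row x, Col y} = Row x}"
  have edge: "{Row x, Col y} \<in> spine_edges P" if "(x, y) \<in> P" for x y
    using that by (auto simp: spine_edges_def)
  have inj: "x = x' \<and> y = y'"
    if "(x, y) \<in> P" "(x', y') \<in> P" "f {Row x, Col y} = f {Row x', Col y'}" for x y x' y'
    using inj_onD[OF f(1) that(3) edge edge] that by (auto simp: doubleton_eq_iff)
  have "P = P1 \<union> P2" using edge f(2) by (fastforce simp: P1_def P2_def)
  moreover have "P1 \<inter> P2 = {}" by (auto simp: P1_def P2_def)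
  moreover have "\<forall>y. \<exists>\<^sub>\<le>\<^sub>1 x. (x, y) \<in> P1" "\<forall>x. \<exists>\<^sub>\<le>\<^sub>1 y. (x, y) \<in> P2"
    using inj by (auto simp: Uniq_def P1_def P2_def)
  ultimately show "coverable P" unfolding coverable_def by blast
qed

theorem lemma4p1:
  fixes q :: nat and P :: "(nat \<times> nat) set"
  assumes "q > 0"
    and "P \<subseteq> Omega2 q"
  shows "(coverable P \<longleftrightarrow> pseudoforest (spine_vertices q) (spine_edges P)) \<and>
    (pseudoforest (spine_vertices q) (spine_edges P) \<longleftrightarrow>
      (\<forall>C \<in> components (spine_vertices q) (spine_edges P).
        \<exists>\<^sub>\<le>\<^sub>1 F. F \<in> cycles (induced_edges (spine_edges P) C)))"
proof
  have "Omega2 q \<subseteq> {0..<q} \<times> {0..<q}" by (auto simp: Omega2_def)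
  then have P: "P \<subseteq> {0..<q} \<times> {0..<q}" using assms(2) by blast
  then have "finite P" by (rule finite_subset) simp
  then have "finite (spine_edges P)" by (simp add: spine_edges_image)
  moreover have "\<forall>e \<in> spine_edges P. card e = 2" by (auto simp: spine_edges_def)
  moreover have "e \<subseteq> spine_vertices q" if "e \<in> spine_edges P" for e
    using that P by (auto simp: spine_edges_def spine_vertices_def)
  ultimately show "coverable P \<longleftrightarrow> pseudoforest (spine_vertices q) (spine_edges P)"
    by (simp add: coverable_iff_orientation orientation_iff_cycles_separated
        pseudoforest_iff_cycles_separated)
qed (simp add: pseudoforest_def)

end
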